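(* Let $f:\mathbb{R}^2\to\mathbb{R}^2$ be a $C^1$ function and suppose that its critical set $S$ is nowhere dense. Let $w_0\in C(f,\infty)$ be such that either (i) $Val(f,w_0)<\infty$, or (ii) $Val(f,w_0)=\infty$ and $w_0\notin f(S)$. Suppose that there exists $\epsilon>0$ such that: (1) $C(f,\infty)$ is nowhere dense in $B(w_0,\epsilon)$; (2) $B(w_0,\epsilon)\setminus(f(S)\cup C(f,\infty))$ consists of finitely many components (connected components), each of which is uniformly locally arcwise connected. Then $w_0$ is an asymptotic value of $f$.
   Context: Notation: $B(w_0,r)=\{w\in\mathbb{R}^2:|w-w_0|<r\}$. $J_f$ is the Jacobian determinant of $f$ and $S=\{z\in\mathbb{R}^2:J_f(z)=0\}$ is the critical set. The cluster set $C(f,\infty)$ is the set of $w\in\mathbb{R}^2$ for which there is a sequence $z_n\to\infty$ in $\mathbb{R}^2$ with $f(z_n)\to w$. $Val(f,w)$ is the number of distinct points $z\in\mathbb{R}^2$ with $f(z)=w$ (possibly $\infty$). A point $w_0\in C(f,\infty)$ is an asymptotic value of $f$ if there is a continuous $\gamma:[0,\infty)\to\mathbb{R}^2$ with $\gamma(t)\to\infty$ and $f(\gamma(t))\to w_0$ as $t\to\infty$. A set $U\subseteq\mathbb{R}^2$ is uniformly locally arcwise connected if for each $\epsilon'>0$ there exists $\delta>0$ such that any two distinct points $z_1,z_2\in U$ with $|z_1-z_2|<\delta$ can be joined by an arc in $U$ of diameter less than $\epsilon'$. *)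

theory Defs
  imports "HOL-Analysis.Analysis" "HOL-Library.Extended_Nat"
begin

definition C1_map :: "('a::real_normed_vector \<Rightarrow> 'b::real_normed_vector) \<Rightarrow> bool"
  where "C1_map f \<longleftrightarrow>
    (\<exists>f' :: 'a \<Rightarrow> 'a \<Rightarrow>\<^sub>L 'b.
      (\<forall>z. (f has_derivative blinfun_apply (f' z)) (at z)) \<and> continuous_on UNIV f')"

definition critical_set :: "(real^'n \<Rightarrow> real^'n) \<Rightarrow> (real^'n) set"
  where "critical_set f = {z. det (jacobian f (at z)) = 0}"

text \<open>For \<open>S\<close> inside a subset \<open>B\<close> of the plane, "nowhere dense in \<open>B\<close>" is
  \<open>nowhere_dense_in (top_of_set B) S\<close>.\<close>

definition nowhere_dense_in :: "'a topology \<Rightarrow> 'a set \<Rightarrow> bool"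
  where "nowhere_dense_in X S \<longleftrightarrow> X interior_of (X closure_of S) = {}"

definition cluster_set_at_infinity ::
    "('a::real_normed_vector \<Rightarrow> 'b::topological_space) \<Rightarrow> 'b set"
  where "cluster_set_at_infinity f =
    {w. \<exists>z :: nat \<Rightarrow> 'a. filterlim z at_infinity sequentially \<and> (\<lambda>n. f (z n)) \<longlonglongrightarrow> w}"

definition Val :: "('a \<Rightarrow> 'b) \<Rightarrow> 'b \<Rightarrow> enat"
  where "Val f w = (if finite {z. f z = w} then enat (card {z. f z = w}) else \<infinity>)"

definition asymptotic_value ::
    "('a::real_normed_vector \<Rightarrow> 'b::topological_space) \<Rightarrow> 'b \<Rightarrow> bool"
  where "asymptotic_value f w \<longleftrightarrow>
    w \<in> cluster_set_at_infinity f \<and>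
    (\<exists>\<gamma> :: real \<Rightarrow> 'a. continuous_on {0..} \<gamma> \<and>
       filterlim \<gamma> at_infinity at_top \<and> ((\<lambda>t. f (\<gamma> t)) \<longlongrightarrow> w) at_top)"

definition uniformly_locally_arcwise_connected :: "'a::metric_space set \<Rightarrow> bool"
  where "uniformly_locally_arcwise_connected U \<longleftrightarrow>
    (\<forall>e>0. \<exists>d>0. \<forall>z1\<in>U. \<forall>z2\<in>U. z1 \<noteq> z2 \<and> dist z1 z2 < d \<longrightarrow>
      (\<exists>g. arc g \<and> pathstart g = z1 \<and> pathfinish g = z2 \<and>
           path_image g \<subseteq> U \<and> diameter (path_image g) < e))"

end

theory Submission
  imports Defs
begin

text \<open>
  The asymptotic path is a lift through \<open>f\<close> of a path of regular values that tends to \<open>w0\<close>.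

  Since \<open>w0\<close> is a cluster value, there are points \<open>z n\<close> tending to infinity with \<open>f (z n)\<close> tending
  to \<open>w0\<close>. By Sard's theorem and the nowhere density of the critical set and of the cluster set,
  the \<open>z n\<close> can be moved slightly so that each \<open>f (z n)\<close> avoids critical values and cluster values
  (\<open>regular_sequence_to_cluster_value\<close>). Finitely many components are available, so a subsequence
  of the values stays in one component \<open>U\<close>. As \<open>U\<close> is uniformly locally arcwise connected,
  consecutive values of a further subsequence can be joined in \<open>U\<close> by arcs shrinking to \<open>w0\<close>. The
  result is a path \<open>p : [0, \<infinity>) \<rightarrow> U\<close> with limit \<open>w0\<close> (\<open>path_through_subsequence\<close>).

  Over \<open>U\<close> the map is proper, because \<open>U\<close> misses the cluster set, and a local homeomorphism,
  because \<open>U\<close> misses the critical values. Hence it is a covering with finite fibres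
  (\<open>proper_local_homeomorphism_imp_covering_space\<close>), and \<open>p\<close> can be lifted. Different lifts may
  behave differently: some may converge to points of the fibre over \<open>w0\<close>. But there are only
  finitely many lifts and every \<open>z n\<close> of the subsequence lies on one of them, so one lift \<open>g\<close> meets
  infinitely many \<open>z n\<close> and is unbounded (\<open>lift_through_infinitely_many_points\<close>).

  It remains to exclude that \<open>g\<close> oscillates. Either assumption on \<open>w0\<close> makes its fibre consist of
  isolated points. A small sphere around such a point has an image at positive distance from \<open>w0\<close>,
  so at late times \<open>g\<close> cannot cross it; since \<open>g\<close> is unbounded, it must leave every bounded set for
  good (\<open>filterlim_at_infinity_of_isolated_fibre\<close>).
\<close>

section \<open>Regular points and critical values of a continuously differentiable map\<close>

text \<open>The image \<open>T\<close> is required to be open, so that openness of the map near \<open>x\<close> is part of the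
  notion and does not rest on invariance of domain.\<close>

definition local_homeomorphism_at :: "('a::topological_space \<Rightarrow> 'b::topological_space) \<Rightarrow> 'a \<Rightarrow> bool"
  where "local_homeomorphism_at f x \<longleftrightarrow>
    (\<exists>V T g. open V \<and> x \<in> V \<and> open T \<and> homeomorphism V T f g)"

lemma C1_map_imp_continuous_on:
  assumes "C1_map f"
  shows "continuous_on A f"
  using assms unfolding C1_map_def
  by (meson continuous_at_imp_continuous_on has_derivative_continuous)

lemma jacobian_eq_matrix:
  fixes f :: "real^'n \<Rightarrow> real^'n"
  assumes "(f has_derivative D) (at z)"
  shows "jacobian f (at z) = matrix D"
  using frechet_derivative_at[OF assms] by (simp add: jacobian_def)

lemma local_homeomorphism_at_regular_point:
  fixes f :: "real^'n \<Rightarrow> real^'n"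
  assumes "C1_map f" "x \<notin> critical_set f"
  shows "local_homeomorphism_at f x"
proof -
  obtain f' where f': "\<And>z. (f has_derivative blinfun_apply (f' z)) (at z)"
    and cont: "continuous_on UNIV f'"
    using assms(1) unfolding C1_map_def by blast
  define J where "J = jacobian f (at x)"
  have "invertible J"
    using assms(2) by (simp add: critical_set_def J_def invertible_det_nz)
  then obtain K where inv: "K ** J = mat 1"
    unfolding invertible_left_inverse by blast
  have "(f has_derivative (\<lambda>h. J *v h)) (at x)"
    unfolding J_def using f' jacobian_works by (metis differentiableI)
  then have J: "blinfun_apply (f' x) = (\<lambda>h. J *v h)"
    by (rule has_derivative_unique[OF f'])
  have "Blinfun ((*v) (K)) o\<^sub>L f' x = id_blinfun"
    by (rule blinfun_eqI)
      (simp add: bounded_linear_Blinfun_apply matrix_vector_mul_bounded_linear J matrix_vector_mul_assoc inv)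
  then obtain V T g where "open V" "x \<in> V" "open T" "homeomorphism V T f g"
    using inverse_function_theorem[of UNIV f f' x] f' cont by (metis UNIV_I open_UNIV)
  then show ?thesis
    unfolding local_homeomorphism_at_def by blast
qed

lemma closed_critical_set:
  fixes f :: "real^'n \<Rightarrow> real^'n"
  assumes "C1_map f"
  shows "closed (critical_set f)"
proof -
  obtain f' where f': "\<And>z. (f has_derivative blinfun_apply (f' z)) (at z)"
    and cont: "continuous_on UNIV f'"
    using assms(1) unfolding C1_map_def by blast
  have "continuous_on UNIV (\<lambda>z. det (matrix (blinfun_apply (f' z))))"
    unfolding det_def matrix_def
    by (simp, intro continuous_intros cont)
  then have "closed {z. det (matrix (blinfun_apply (f' z))) = 0}"
    by (intro closed_Collect_eq continuous_intros)
  then show ?thesis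
    by (simp add: critical_set_def jacobian_eq_matrix[OF f'])
qed

text \<open>Sard's theorem in equal dimensions. It keeps the critical values from filling an open set.\<close>

lemma negligible_critical_values:
  fixes f :: "real^'n::{finite,wellorder} \<Rightarrow> real^'n::{finite,wellorder}"
  assumes "C1_map f"
  shows "negligible (f ` critical_set f)"
proof -
  obtain f' where f': "\<And>z. (f has_derivative blinfun_apply (f' z)) (at z)"
    using assms(1) unfolding C1_map_def by blast
  show ?thesis
  proof (rule baby_Sard)
    show "(f has_derivative blinfun_apply (f' x)) (at x within critical_set f)" for x
      using f' has_derivative_at_withinI by blast
    show "rank (matrix (blinfun_apply (f' x))) < CARD('n)" if "x \<in> critical_set f" for x
      using that by (simp add: critical_set_def jacobian_eq_matrix[OF f'] det_eq_0_rank)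
  qed simp
qed

section \<open>The cluster set at infinity and properness\<close>

lemma tendsto_of_dist_less_inverse_Suc:
  assumes "\<And>n. dist (X n) w < inverse (real (Suc n))"
  shows "X \<longlonglongrightarrow> w"
proof (rule metric_LIMSEQ_I)
  fix e :: real assume "e > 0"
  then obtain N where N: "inverse (real (Suc N)) < e"
    using reals_Archimedean by blast
  have "dist (X n) w < e" if "n \<ge> N" for n
  proof -
    have "inverse (real (Suc n)) \<le> inverse (real (Suc N))"
      using that by (intro le_imp_inverse_le) simp_all
    then show ?thesis
      using assms[of n] N by linarith
  qed
  then show "\<exists>N. \<forall>n\<ge>N. dist (X n) w < e" by blast
qed

lemma cluster_set_at_infinity_iff:
  fixes f :: "'a::real_normed_vector \<Rightarrow> 'b::metric_space"
  shows "w \<in> cluster_set_at_infinity f \<longleftrightarrow> (\<forall>e>0. \<forall>R. \<exists>z. norm z \<ge> R \<and> dist (f z) w < e)"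
    (is "_ \<longleftrightarrow> ?R")
proof
  assume "w \<in> cluster_set_at_infinity f"
  then obtain z where z: "filterlim z at_infinity sequentially" "(\<lambda>n. f (z n)) \<longlonglongrightarrow> w"
    unfolding cluster_set_at_infinity_def by auto
  show ?R
  proof (intro allI impI)
    fix e R :: real assume "e > 0"
    have "\<forall>\<^sub>F n in sequentially. dist (f (z n)) w < e"
      using z(2) \<open>e > 0\<close> tendstoD by blast
    moreover have "\<forall>\<^sub>F n in sequentially. norm (z n) \<ge> R"
      using filterlim_at_infinity_imp_norm_at_top[OF z(1)] by (simp add: filterlim_at_top)
    ultimately have "\<forall>\<^sub>F n in sequentially. norm (z n) \<ge> R \<and> dist (f (z n)) w < e"
      by eventually_elim auto
    then show "\<exists>z. norm z \<ge> R \<and> dist (f z) w < e"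
      by (metis (mono_tags, lifting) eventually_happens' sequentially_bot)
  qed
next
  assume R: ?R
  have "\<forall>n. \<exists>z. norm z \<ge> real n \<and> dist (f z) w < inverse (real (Suc n))"
    using R by (meson inverse_positive_iff_positive of_nat_0_less_iff zero_less_Suc)
  then obtain z where z: "\<And>n. norm (z n) \<ge> real n" "\<And>n. dist (f (z n)) w < inverse (real (Suc n))"
    by metis
  have "filterlim (\<lambda>n. norm (z n)) at_top sequentially"
    by (rule filterlim_at_top_mono[OF filterlim_real_sequentially]) (use z in auto)
  then have "filterlim z at_infinity sequentially"
    by (rule filterlim_norm_at_top_imp_at_infinity)
  moreover have "(\<lambda>n. f (z n)) \<longlonglongrightarrow> w"
    using z(2) by (rule tendsto_of_dist_less_inverse_Suc)
  ultimately show "w \<in> cluster_set_at_infinity f"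
    unfolding cluster_set_at_infinity_def by blast
qed

lemma bounded_preimage_off_cluster_set:
  fixes f :: "'a::real_normed_vector \<Rightarrow> 'b::metric_space"
  assumes "w \<notin> cluster_set_at_infinity f"
  obtains e R where "e > 0" "f -` ball w e \<subseteq> cball 0 R"
proof -
  obtain e R where "e > 0" "\<And>z. norm z \<ge> R \<Longrightarrow> \<not> dist (f z) w < e"
    using assms unfolding cluster_set_at_infinity_iff by blast
  then have "f -` ball w e \<subseteq> cball 0 R"
    by (auto simp: dist_commute) (meson linear)
  with \<open>e > 0\<close> that show thesis by blast
qed

lemma closed_cluster_set_at_infinity:
  fixes f :: "'a::real_normed_vector \<Rightarrow> 'b::metric_space"
  shows "closed (cluster_set_at_infinity f)"
  unfolding closed_limpt islimpt_approachable
proof (intro allI impI)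
  fix w assume w: "\<forall>e>0. \<exists>v\<in>cluster_set_at_infinity f. v \<noteq> w \<and> dist v w < e"
  show "w \<in> cluster_set_at_infinity f"
    unfolding cluster_set_at_infinity_iff
  proof (intro allI impI)
    fix e R :: real assume "e > 0"
    then obtain v where v: "v \<in> cluster_set_at_infinity f" "dist v w < e/2"
      using w by (meson half_gt_zero)
    then obtain z where "norm z \<ge> R" "dist (f z) v < e/2"
      using \<open>e > 0\<close> unfolding cluster_set_at_infinity_iff by (meson half_gt_zero)
    with v show "\<exists>z. norm z \<ge> R \<and> dist (f z) w < e"
      using dist_triangle_half_r[of v "f z" e w] by (metis dist_commute)
  qed
qed

text \<open>The cluster set is exactly the obstruction to properness: every value outside it has a
  neighbourhood with bounded preimage, and finitely many of these cover a compact set.\<close>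

lemma compact_preimage_off_cluster_set:
  fixes f :: "'a::euclidean_space \<Rightarrow> 'b::metric_space"
  assumes f: "continuous_on UNIV f" and K: "compact K" "K \<inter> cluster_set_at_infinity f = {}"
  shows "compact (f -` K)"
proof -
  have "\<exists>e R. e > 0 \<and> f -` ball w e \<subseteq> cball 0 R" if "w \<in> K" for w
    using that K(2) bounded_preimage_off_cluster_set by (metis IntI empty_iff)
  then obtain e R where eR: "\<And>w. w \<in> K \<Longrightarrow> e w > 0 \<and> f -` ball w (e w) \<subseteq> cball 0 (R w)"
    by metis
  obtain F where F: "F \<subseteq> K" "finite F" "K \<subseteq> (\<Union>w\<in>F. ball w (e w))"
    by (rule compactE_image[OF K(1), of K "\<lambda>w. ball w (e w)"]) (use eR in auto)
  have "f -` K \<subseteq> (\<Union>w\<in>F. cball 0 (R w))"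
  proof
    fix z assume "z \<in> f -` K"
    then obtain w where "w \<in> F" "f z \<in> ball w (e w)"
      using F(3) by auto
    then show "z \<in> (\<Union>w\<in>F. cball 0 (R w))"
      using eR F(1) by blast
  qed
  moreover have "bounded (\<Union>w\<in>F. cball (0::'a) (R w))"
    using F(2) by auto
  ultimately have "bounded (f -` K)"
    using bounded_subset by blast
  moreover have "closed (f -` K)"
    using f K(1) by (simp add: closed_vimage compact_imp_closed)
  ultimately show ?thesis
    by (simp add: compact_eq_bounded_closed)
qed

text \<open>The image of a closed set need not be closed, but only values taken near infinity can be
  missing, and these lie in the cluster set. Away from it the image is locally that of the
  compact set \<open>S \<inter> cball 0 R\<close>.\<close>

lemma closed_image_Un_cluster_set:
  fixes f :: "'a::euclidean_space \<Rightarrow> 'b::metric_space"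
  assumes f: "continuous_on UNIV f" and S: "closed S"
  shows "closed (f ` S \<union> cluster_set_at_infinity f)"
  unfolding closed_def
proof (subst open_subopen, intro ballI)
  fix w assume w: "w \<in> - (f ` S \<union> cluster_set_at_infinity f)"
  then obtain e R where e: "e > 0" and R: "f -` ball w e \<subseteq> cball 0 R"
    using bounded_preimage_off_cluster_set[of w f] by blast
  define T where "T = ball w e - f ` (S \<inter> cball 0 R) - cluster_set_at_infinity f"
  have "compact (f ` (S \<inter> cball 0 R))"
    using S f by (intro compact_continuous_image closed_Int_compact) (auto intro: continuous_on_subset)
  then have "open T"
    unfolding T_def using closed_cluster_set_at_infinity by (intro open_Diff) (auto intro: compact_imp_closed)
  moreover have "w \<in> T"
    using w e unfolding T_def by auto
  moreover have "T \<subseteq> - (f ` S \<union> cluster_set_at_infinity f)"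
    using R unfolding T_def by auto
  ultimately show "\<exists>T. open T \<and> w \<in> T \<and> T \<subseteq> - (f ` S \<union> cluster_set_at_infinity f)"
    by (intro exI[of _ T]) simp
qed

section \<open>Proper local homeomorphisms are covering maps\<close>

lemma finite_imp_uniform_discrete:
  fixes S :: "'a::metric_space set"
  assumes "finite S"
  shows "uniform_discrete S"
  using assms by (induction S rule: finite_induct) (auto simp: uniform_discrete_insert)

lemma local_homeomorphism_at_shrink:
  assumes "local_homeomorphism_at f x" "open W" "x \<in> W"
  obtains V g where "open V" "x \<in> V" "V \<subseteq> W" "open (f ` V)" "homeomorphism V (f ` V) f g"
proof -
  obtain V T g where V: "open V" "x \<in> V" "open T" and hom: "homeomorphism V T f g"
    using assms(1) unfolding local_homeomorphism_at_def by blast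
  have "openin (top_of_set V) (V \<inter> W)"
    using assms(2) by (rule openin_open_Int)
  then have "openin (top_of_set T) (f ` (V \<inter> W))"
    by (rule homeomorphism_imp_open_map[OF hom])
  then have "open (f ` (V \<inter> W))"
    using \<open>open T\<close> by (rule openin_open_trans)
  moreover have "homeomorphism (V \<inter> W) (f ` (V \<inter> W)) f g"
    by (rule homeomorphism_of_subsets[OF hom]) (use homeomorphism_image1[OF hom] in blast)+
  moreover have "open (V \<inter> W)" "x \<in> V \<inter> W" "V \<inter> W \<subseteq> W"
    using V assms(2,3) by auto
  ultimately show thesis
    by (intro that[of "V \<inter> W" g])
qed

lemma local_homeomorphism_at_isolated_in_fibre:
  assumes "local_homeomorphism_at f x"
  shows "\<not> x islimpt (f -` {f x})"
proof -
  obtain V g where V: "open V" "x \<in> V" "homeomorphism V (f ` V) f g"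
    using assms open_UNIV UNIV_I by (rule local_homeomorphism_at_shrink)
  have "y = x" if "y \<in> f -` {f x}" "y \<in> V" for y
    using homeomorphism_apply1[OF V(3)] that V(2) by (metis singletonD vimageE)
  then show ?thesis
    using V(1,2) by (meson islimptE)
qed

lemma finite_compact_fibre_of_local_homeomorphism:
  fixes f :: "'a::topological_space \<Rightarrow> 'b::topological_space"
  assumes "compact (f -` {w})" and loc: "\<And>x. f x = w \<Longrightarrow> local_homeomorphism_at f x"
  shows "finite (f -` {w})"
proof -
  have "\<not> x islimpt f -` {w}" if "x \<in> f -` {w}" for x
    using local_homeomorphism_at_isolated_in_fibre[OF loc, of x] that by simp
  then have "finite (f -` {w} \<inter> f -` {w})"
    by (rule finite_not_islimpt_in_compact[OF assms(1)])
  then show ?thesis by simp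
qed

text \<open>Fibres are finite, being compact and discrete. Around the points \<open>p\<close> of the fibre over \<open>w\<close>
  there are disjoint open sets \<open>V p\<close> mapped homeomorphically. Properness makes \<open>f\<close> a closed map,
  so the image of the complement \<open>D\<close> of these sets is closed and misses \<open>w\<close>; removing it from the
  common image leaves an evenly covered neighbourhood \<open>T\<close>, because no other preimages remain.
  Surjectivity holds since the image is open and closed in the connected set \<open>W\<close>.\<close>

lemma proper_local_homeomorphism_imp_covering_space:
  fixes f :: "'a::heine_borel \<Rightarrow> 'b::heine_borel"
  assumes f: "continuous_on UNIV f" and W: "open W" "connected W" "f -` W \<noteq> {}"
    and loc: "\<And>x. f x \<in> W \<Longrightarrow> local_homeomorphism_at f x"
    and proper: "\<And>K. K \<subseteq> W \<Longrightarrow> compact K \<Longrightarrow> compact (f -` K)"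
  shows "covering_space (f -` W) f W"
proof
  define C where "C = f -` W"
  have "open C"
    unfolding C_def using f W(1) by (simp add: open_vimage)
  have closed_map: "closedin (top_of_set W) (f ` D)" if "closedin (top_of_set C) D" for D
    using that
  proof (rule proper_map)
    show "compact (C \<inter> f -` K)" if "K \<subseteq> W" "compact K" for K
    proof -
      have "C \<inter> f -` K = f -` K"
        using that C_def by auto
      then show ?thesis
        using that proper by simp
    qed
  qed (auto simp: C_def)
  have "open (f ` C)"
  proof (subst open_subopen, intro ballI)
    fix w assume "w \<in> f ` C"
    then obtain x where x: "x \<in> C" "w = f x" by auto
    then have "local_homeomorphism_at f x"
      by (intro loc) (simp add: C_def)
    then obtain V g where "x \<in> V" "V \<subseteq> C" "open (f ` V)"
      using \<open>open C\<close> x(1) by (rule local_homeomorphism_at_shrink)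
    with x show "\<exists>T. open T \<and> w \<in> T \<and> T \<subseteq> f ` C"
      by (intro exI[of _ "f ` V"]) auto
  qed
  then have "openin (top_of_set W) (f ` C)"
    unfolding C_def by (intro open_subset) auto
  moreover have "closedin (top_of_set W) (f ` C)"
    by (rule closed_map) simp
  ultimately show "f ` (f -` W) = W"
    using W(2,3) unfolding connected_clopen C_def by (metis image_is_empty)
  show "continuous_on (f -` W) f"
    using f continuous_on_subset by blast
  fix w assume w: "w \<in> W"
  define P where "P = f -` {w}"
  have "P \<subseteq> C"
    using w by (auto simp: P_def C_def)
  have "finite P"
    unfolding P_def using w by (intro finite_compact_fibre_of_local_homeomorphism proper loc) auto
  then obtain d where d: "d > 0" "\<And>x y. x \<in> P \<Longrightarrow> y \<in> P \<Longrightarrow> dist x y < d \<Longrightarrow> x = y"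
    using finite_imp_uniform_discrete unfolding uniform_discrete_def by metis
  have "\<exists>V g. open V \<and> p \<in> V \<and> V \<subseteq> C \<inter> ball p (d/2) \<and> open (f ` V) \<and> homeomorphism V (f ` V) f g"
    if "p \<in> P" for p
  proof -
    have "local_homeomorphism_at f p"
      using that w by (intro loc) (auto simp: P_def)
    then show ?thesis
      by (rule local_homeomorphism_at_shrink[of f p "C \<inter> ball p (d/2)"])
        (use \<open>open C\<close> \<open>P \<subseteq> C\<close> that \<open>d > 0\<close> in auto)
  qed
  then obtain V g where Vg: "\<forall>p\<in>P. open (V p) \<and> p \<in> V p \<and> V p \<subseteq> C \<inter> ball p (d/2) \<and>
      open (f ` V p) \<and> homeomorphism (V p) (f ` V p) f (g p)"
    by metis
  then have V: "\<And>p. p \<in> P \<Longrightarrow> open (V p)" "\<And>p. p \<in> P \<Longrightarrow> p \<in> V p"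
    "\<And>p. p \<in> P \<Longrightarrow> V p \<subseteq> C" "\<And>p. p \<in> P \<Longrightarrow> V p \<subseteq> ball p (d/2)"
    "\<And>p. p \<in> P \<Longrightarrow> open (f ` V p)"
    and hom: "\<And>p. p \<in> P \<Longrightarrow> homeomorphism (V p) (f ` V p) f (g p)"
    by simp_all
  define D where "D = C - (\<Union>p\<in>P. V p)"
  define T where "T = (W \<inter> (\<Inter>p\<in>P. f ` V p)) - f ` D"
  have "D = C \<inter> - (\<Union>p\<in>P. V p)"
    unfolding D_def by auto
  moreover have "closed (- (\<Union>p\<in>P. V p))"
    using V(1) by (intro closed_Compl open_UN) auto
  ultimately have "closedin (top_of_set C) D"
    using closedin_closed_Int by metis
  then have closed_fD: "closedin (top_of_set W) (f ` D)"
    by (rule closed_map)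
  have "openin (top_of_set W) (W \<inter> (\<Inter>p\<in>P. f ` V p))"
    using \<open>finite P\<close> V(5) by (intro openin_open_Int open_INT) auto
  then have "openin (top_of_set W) T"
    unfolding T_def using closed_fD by (rule openin_diff)
  have "open T"
    using \<open>openin (top_of_set W) T\<close> W(1) openin_open_trans by blast
  have "w \<in> T"
    using w V(2) unfolding T_def D_def P_def by auto
  define \<V> where "\<V> = (\<lambda>p. V p \<inter> f -` T) ` P"
  have "\<Union>\<V> = C \<inter> f -` T"
    using V(3) unfolding \<V>_def T_def D_def by auto
  moreover have "openin (top_of_set C) u" if "u \<in> \<V>" for u
  proof -
    have "open u"
      using that V(1) \<open>open T\<close> f unfolding \<V>_def by (auto intro!: open_Int open_vimage)
    moreover have "u \<subseteq> C"
      using that V(3) unfolding \<V>_def by auto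
    ultimately show ?thesis
      by (simp add: open_subset)
  qed
  moreover have "pairwise disjnt \<V>"
    unfolding pairwise_def
  proof (intro ballI impI)
    fix u v assume "u \<in> \<V>" "v \<in> \<V>" "u \<noteq> v"
    then obtain p q where pq: "p \<in> P" "q \<in> P" "p \<noteq> q" "u \<subseteq> V p" "v \<subseteq> V q"
      unfolding \<V>_def by auto
    have "x \<notin> V p \<inter> V q" for x
    proof
      assume "x \<in> V p \<inter> V q"
      then have "x \<in> ball p (d/2)" "x \<in> ball q (d/2)"
        using V(4)[of p] V(4)[of q] pq(1,2) by blast+
      then have "dist p x < d/2" "dist q x < d/2"
        by (simp_all only: mem_ball)
      then have "dist p q < d"
        using dist_triangle2[of p q x] by linarith
      then show False using d(2) pq by blast
    qed
    then show "disjnt u v"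
      using pq unfolding disjnt_def by blast
  qed
  moreover have "\<exists>q. homeomorphism u T f q" if "u \<in> \<V>" for u
  proof -
    obtain p where p: "p \<in> P" "u = V p \<inter> f -` T"
      using \<open>u \<in> \<V>\<close> unfolding \<V>_def by (rule imageE) simp
    have "T \<subseteq> f ` V p"
      using p(1) unfolding T_def by auto
    then have "f ` u = T"
      unfolding p(2) by auto
    then have "homeomorphism u T f (g p)"
      by (intro homeomorphism_of_subsets[OF hom[OF p(1)]])
        (use p(2) \<open>T \<subseteq> f ` V p\<close> in auto)
    then show ?thesis by (intro exI[of _ "g p"])
  qed
  ultimately show "\<exists>T. w \<in> T \<and> openin (top_of_set W) T \<and>
      (\<exists>v. \<Union>v = f -` W \<inter> f -` T \<and> Ball v (openin (top_of_set (f -` W))) \<and> pairwise disjnt v \<and>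
        (\<forall>u\<in>v. \<exists>q. homeomorphism u T f q))"
    using \<open>w \<in> T\<close> \<open>openin (top_of_set W) T\<close> unfolding C_def
    by (intro exI[of _ T] exI[of _ \<V>] conjI ballI) simp_all
qed

section \<open>A path of regular values ending at the cluster value\<close>

lemma concatenate_paths:
  fixes q :: "nat \<Rightarrow> real \<Rightarrow> 'a::topological_space"
  assumes q: "\<And>n. path (q n)" and join: "\<And>n. pathfinish (q n) = pathstart (q (Suc n))"
  obtains p where "continuous_on {0..} p" "\<And>n. p (real n) = pathstart (q n)"
    "\<And>n t. real n \<le> t \<Longrightarrow> t \<le> real (Suc n) \<Longrightarrow> p t \<in> path_image (q n)"
proof
  define p where "p t = q (nat \<lfloor>t\<rfloor>) (t - of_int \<lfloor>t\<rfloor>)" for t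
  have p_on: "p t = q n (t - real n)" if "real n \<le> t" "t \<le> real (Suc n)" for n t
  proof (cases "t = real (Suc n)")
    case True
    have "\<lfloor>t\<rfloor> = int (Suc n)"
      unfolding True by (rule floor_of_nat)
    then have "nat \<lfloor>t\<rfloor> = Suc n" "t - of_int \<lfloor>t\<rfloor> = 0" "t - real n = 1"
      using True by simp_all
    then show ?thesis
      using join[of n] by (simp add: p_def pathfinish_def pathstart_def)
  next
    case False
    then have "\<lfloor>t\<rfloor> = int n"
      using that by (simp add: floor_eq_iff)
    then show ?thesis by (simp add: p_def)
  qed
  show "p (real n) = pathstart (q n)" for n
    by (simp add: p_def pathstart_def)
  show "p t \<in> path_image (q n)" if "real n \<le> t" "t \<le> real (Suc n)" for n t
    using that by (auto simp: p_on path_image_def)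
  have cont_piece: "continuous_on {real n..real (Suc n)} p" for n
  proof (subst continuous_on_cong[OF refl])
    show "p t = q n (t - real n)" if "t \<in> {real n..real (Suc n)}" for t
      using that by (intro p_on) auto
    show "continuous_on {real n..real (Suc n)} (\<lambda>t. q n (t - real n))"
      using q[of n] unfolding path_def
      by (rule continuous_on_compose2) (auto intro!: continuous_intros)
  qed
  have cont_upto: "continuous_on {0..real n} p" for n
  proof (induction n)
    case 0
    then show ?case by simp
  next
    case (Suc n)
    have "continuous_on ({0..real n} \<union> {real n..real (Suc n)}) p"
      using Suc cont_piece by (intro continuous_on_closed_Un) auto
    moreover have "{0..real n} \<union> {real n..real (Suc n)} = {0..real (Suc n)}"
      by auto
    ultimately show ?case by simp
  qed
  show "continuous_on {0..} p"
    unfolding continuous_on_eq_continuous_within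
  proof
    fix t :: real assume t: "t \<in> {0..}"
    obtain n where n: "t < real n"
      using reals_Archimedean2 by blast
    have "continuous (at t within {0..real n}) p"
      using cont_upto[of n] t n by (simp add: continuous_on_eq_continuous_within)
    moreover have "at t within {0..} = at t within {0..real n}"
      by (rule at_within_nhd[of _ "{..<real n}"]) (use n in auto)
    ultimately show "continuous (at t within {0..}) p"
      by simp
  qed
qed

text \<open>Uniformity matters because \<open>w0\<close> lies on the boundary of \<open>U\<close> in general: points of the
  sequence that are close to each other are joined by an arc of small diameter, and such an arc
  stays near \<open>w0\<close> because its end points do.\<close>

lemma uniformly_locally_arcwise_connected_tail_paths:
  fixes w :: "nat \<Rightarrow> 'a::real_normed_vector"
  assumes U: "uniformly_locally_arcwise_connected U" "\<And>n. w n \<in> U"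
    and w: "w \<longlonglongrightarrow> w0" and e: "e > 0"
  shows "\<exists>N. \<forall>m\<ge>N. \<forall>n\<ge>N. \<exists>g. path g \<and> pathstart g = w m \<and> pathfinish g = w n \<and>
    path_image g \<subseteq> U \<inter> ball w0 e"
proof -
  obtain d where "d > 0" and d: "\<And>x y. x \<in> U \<Longrightarrow> y \<in> U \<Longrightarrow> x \<noteq> y \<Longrightarrow> dist x y < d \<Longrightarrow>
      \<exists>g. arc g \<and> pathstart g = x \<and> pathfinish g = y \<and> path_image g \<subseteq> U \<and>
        diameter (path_image g) < e/2"
    using U(1) e unfolding uniformly_locally_arcwise_connected_def by (metis half_gt_zero)
  obtain N where N: "\<And>n. n \<ge> N \<Longrightarrow> dist (w n) w0 < min (e/2) (d/2)"
    using metric_LIMSEQ_D[OF w, of "min (e/2) (d/2)"] e \<open>d > 0\<close> by auto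
  have "\<exists>g. path g \<and> pathstart g = w m \<and> pathfinish g = w n \<and> path_image g \<subseteq> U \<inter> ball w0 e"
    if mn: "m \<ge> N" "n \<ge> N" for m n
  proof (cases "w m = w n")
    case True
    (* The hypothesis on U joins distinct points only. *)
    have "path_image (linepath (w m) (w m)) \<subseteq> U \<inter> ball w0 e"
      using U(2) N[OF mn(1)] e by (simp add: dist_commute)
    then show ?thesis
      using True by (intro exI[of _ "linepath (w m) (w m)"]) simp
  next
    case False
    have "dist (w m) (w n) < d"
      using N[OF mn(1)] N[OF mn(2)] dist_triangle2[of "w m" "w n" w0] by linarith
    then obtain g where g: "arc g" "pathstart g = w m" "pathfinish g = w n" "path_image g \<subseteq> U"
        "diameter (path_image g) < e/2"
      using d[of "w m" "w n"] U(2) False by auto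
    have "x \<in> ball w0 e" if "x \<in> path_image g" for x
    proof -
      have "dist (w m) x \<le> diameter (path_image g)"
        unfolding g(2)[symmetric] using g(1) that
        by (intro diameter_bounded_bound) (auto simp: arc_imp_path bounded_path_image)
      then show ?thesis
        using g(5) N[OF mn(1)] dist_triangle[of w0 x "w m"] by (simp add: dist_commute)
    qed
    then show ?thesis
      using g arc_imp_path by (intro exI[of _ g]) auto
  qed
  then show ?thesis by blast
qed

text \<open>The subsequence is chosen so that consecutive points from index \<open>i\<close> on can be joined inside
  the ball of radius \<open>1 / (i + 1)\<close>; the infinite concatenation then tends to \<open>w0\<close>.\<close>

lemma path_through_subsequence:
  fixes w :: "nat \<Rightarrow> 'a::real_normed_vector"
  assumes U: "uniformly_locally_arcwise_connected U" "\<And>n. w n \<in> U" and w: "w \<longlonglongrightarrow> w0"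
  obtains r p where "strict_mono r" "continuous_on {0..} p" "p ` {0..} \<subseteq> U"
    "\<forall>n. p (real n) = w (r n)" "(p \<longlongrightarrow> w0) at_top"
proof -
  have "\<exists>N. \<forall>m\<ge>N. \<forall>n\<ge>N. \<exists>g. path g \<and> pathstart g = w m \<and> pathfinish g = w n \<and>
      path_image g \<subseteq> U \<inter> ball w0 (inverse (real (Suc i)))" for i
    by (rule uniformly_locally_arcwise_connected_tail_paths[OF U w]) simp
  then obtain N where N: "\<And>i m n. m \<ge> N i \<Longrightarrow> n \<ge> N i \<Longrightarrow>
      \<exists>g. path g \<and> pathstart g = w m \<and> pathfinish g = w n \<and>
        path_image g \<subseteq> U \<inter> ball w0 (inverse (real (Suc i)))"
    by metis
  (* Both r i and r (i + 1) lie beyond N i, and the summand i makes r strictly increasing. *)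
  define r where "r i = i + (\<Sum>j\<le>i. N j)" for i
  have "strict_mono r"
    by (rule strict_monoI_Suc) (simp add: r_def)
  have r: "r i \<ge> N i" "r (Suc i) \<ge> N i" for i
  proof -
    have "N i \<le> (\<Sum>j\<le>i. N j)"
      by (intro member_le_sum) auto
    then show "r i \<ge> N i" by (simp add: r_def)
    then show "r (Suc i) \<ge> N i"
      using strict_monoD[OF \<open>strict_mono r\<close>, of i "Suc i"] by simp
  qed
  have "\<exists>g. path g \<and> pathstart g = w (r i) \<and> pathfinish g = w (r (Suc i)) \<and>
        path_image g \<subseteq> U \<inter> ball w0 (inverse (real (Suc i)))" for i
    using r by (rule N)
  then obtain q where q: "\<And>i. path (q i)" "\<And>i. pathstart (q i) = w (r i)"
      "\<And>i. pathfinish (q i) = w (r (Suc i))"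
      "\<And>i. path_image (q i) \<subseteq> U \<inter> ball w0 (inverse (real (Suc i)))"
    by metis
  obtain p where p: "continuous_on {0..} p" "\<And>n. p (real n) = pathstart (q n)"
      "\<And>n t. real n \<le> t \<Longrightarrow> t \<le> real (Suc n) \<Longrightarrow> p t \<in> path_image (q n)"
    using concatenate_paths[of q] q(1,2,3) by metis
  have piece: "p t \<in> U \<inter> ball w0 (inverse (real (Suc n)))" if "real n \<le> t" "t \<le> real (Suc n)" for n t
    using p(3)[OF that] q(4)[of n] by blast
  have floor: "real (nat \<lfloor>t\<rfloor>) \<le> t" "t \<le> real (Suc (nat \<lfloor>t\<rfloor>))" if "t \<ge> 0" for t :: real
    using that by linarith+
  have "p ` {0..} \<subseteq> U"
    using piece floor by fastforce
  moreover have "(p \<longlongrightarrow> w0) at_top"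
  proof (rule tendstoI)
    fix e :: real assume "e > 0"
    then obtain m where m: "inverse (real (Suc m)) < e"
      using reals_Archimedean by blast
    have "dist (p t) w0 < e" if "t \<ge> real m" for t
    proof -
      have "t \<ge> 0" "m \<le> nat \<lfloor>t\<rfloor>"
        using that by linarith+
      then have "inverse (real (Suc (nat \<lfloor>t\<rfloor>))) \<le> inverse (real (Suc m))"
        by (intro le_imp_inverse_le) (simp_all only: of_nat_le_iff of_nat_0_less_iff Suc_le_mono zero_less_Suc)
      moreover have "dist w0 (p t) < inverse (real (Suc (nat \<lfloor>t\<rfloor>)))"
        using piece[OF floor[OF \<open>t \<ge> 0\<close>]] by simp
      ultimately show ?thesis
        using m by (simp only: dist_commute[of "p t"])
    qed
    then show "\<forall>\<^sub>F t in at_top. dist (p t) w0 < e"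
      unfolding eventually_at_top_linorder by blast
  qed
  ultimately show thesis
    using that[of r p] \<open>strict_mono r\<close> p(1,2) q(2) by simp
qed

section \<open>Lifting the path\<close>

text \<open>A lift that starts over \<open>p 0\<close> need not follow the prescribed points \<open>z n\<close>. So for every
  \<open>n\<close> the path is lifted with the condition that the lift passes through \<open>z n\<close> at time \<open>n\<close>, and
  the starting points of these lifts are compared. They lie in a finite fibre, so infinitely many
  of them agree, and by uniqueness the lifts concerned are one and the same.\<close>

lemma lift_through_infinitely_many_points:
  fixes f :: "'a::real_normed_vector \<Rightarrow> 'b::real_normed_vector" and p :: "real \<Rightarrow> 'b"
  assumes cov: "covering_space C f U"
    and p: "continuous_on {0..} p" "p ` {0..} \<subseteq> U"
    and fin: "finite {x \<in> C. f x = p 0}"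
    and z: "\<And>n. z n \<in> C" "\<And>n. f (z n) = p (real n)"
  obtains g where "continuous_on {0..} g" "\<forall>t\<ge>0. f (g t) = p t" "infinite {n. g (real n) = z n}"
proof -
  have pU: "p \<in> {0..} \<rightarrow> U"
    using p(2) by auto
  have "\<exists>g. continuous_on {0..} g \<and> g \<in> {0..} \<rightarrow> C \<and> g (real n) = z n \<and> (\<forall>t\<in>{0..}. f (g t) = p t)" for n
  proof -
    have "real n \<in> {0..}" "simply_connected {0::real..}" "locally path_connected {0::real..}"
      by (simp_all add: convex_imp_simply_connected convex_imp_locally_path_connected)
    then show ?thesis
    proof (rule covering_space_lift_strong[OF cov z(1)[of n] _ _ _ p(1) pU z(2)[of n, symmetric]])
      fix h assume "continuous_on {0..} h" "h \<in> {0..} \<rightarrow> C" "h (real n) = z n"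
        "\<And>t. t \<in> {0..} \<Longrightarrow> f (h t) = p t"
      then show ?thesis
        by (intro exI[of _ h]) simp
    qed
  qed
  then obtain g where g: "\<And>n. continuous_on {0..} (g n)" "\<And>n. g n \<in> {0..} \<rightarrow> C"
      "\<And>n. g n (real n) = z n" "\<And>n t. t \<in> {0..} \<Longrightarrow> f (g n t) = p t"
    by metis
  have "(\<lambda>n. g n 0) ` UNIV \<subseteq> {x \<in> C. f x = p 0}"
    using g(2,4) by (simp add: image_subset_iff Pi_iff)
  then have "finite ((\<lambda>n. g n 0) ` UNIV)"
    using fin by (rule finite_subset)
  then obtain k where k: "infinite {n. g n 0 = g k 0}"
    using pigeonhole_infinite[of UNIV "\<lambda>n. g n 0"] by auto
  have "g n t = g k t" if "g n 0 = g k 0" "t \<ge> 0" for n t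
  proof (rule covering_space_lift_unique[OF cov that(1) p(1) pU g(1) g(2) _ g(1) g(2)])
    show "p x = f (g n x)" "p x = f (g k x)" if "x \<in> {0..}" for x
      using g(4) that by simp_all
  qed (use \<open>t \<ge> 0\<close> in auto)
  then have "g k (real n) = z n" if "g n 0 = g k 0" for n
    using that g(3)[of n] by (metis of_nat_0_le_iff)
  then have "{n. g n 0 = g k 0} \<subseteq> {n. g k (real n) = z n}"
    by (intro Collect_mono) simp
  then have "infinite {n. g k (real n) = z n}"
    using k by (rule infinite_super)
  then show thesis
    using g(1,4) by (intro that[of "g k"]) simp_all
qed

text \<open>All finite limit points of \<open>g\<close> lie in the fibre over \<open>w\<close>. If there is one, \<open>a\<close>, a small
  sphere around it avoids the fibre, so its image stays away from \<open>w\<close> and \<open>g\<close> cannot cross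
  it at late times. Being inside at some late time, \<open>g\<close> is then trapped in the ball, which
  contradicts unboundedness.\<close>

lemma filterlim_at_infinity_of_isolated_fibre:
  fixes f :: "'a::euclidean_space \<Rightarrow> 'b::metric_space" and g :: "real \<Rightarrow> 'a"
  assumes f: "continuous_on UNIV f" and g: "continuous_on {0..} g"
    and lim: "((\<lambda>t. f (g t)) \<longlongrightarrow> w) at_top"
    and isolated: "\<And>a. f a = w \<Longrightarrow> \<not> a islimpt (f -` {w})"
    and unbounded: "\<And>T. \<not> bounded (g ` {T..})"
  shows "filterlim g at_infinity at_top"
proof (rule ccontr)
  assume "\<not> filterlim g at_infinity at_top"
  then obtain R where "\<not> (\<forall>\<^sub>F t in at_top. R \<le> norm (g t))"
    unfolding filterlim_at_infinity[OF order_refl] by blast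
  then have "\<exists>t\<ge>T. norm (g t) \<le> R" for T
    unfolding eventually_at_top_linorder by (meson linear)
  then have "\<exists>t. real n \<le> t \<and> norm (g t) \<le> R" for n
    by blast
  then obtain t where t: "\<And>n::nat. t n \<ge> real n" "\<And>n. norm (g (t n)) \<le> R"
    by metis
  have "g (t n) \<in> cball 0 R" for n
    using t(2) by simp
  then obtain a r where r: "strict_mono (r::nat \<Rightarrow> nat)" and a: "((\<lambda>n. g (t n)) \<circ> r) \<longlonglongrightarrow> a"
    using compact_cball[of 0 R] unfolding compact_def by metis
  have t_top: "filterlim (\<lambda>n. t (r n)) at_top sequentially"
  proof (rule filterlim_at_top_mono[OF filterlim_real_sequentially])
    have "real n \<le> t (r n)" for n
      using t(1)[of "r n"] seq_suble[OF r, of n] by linarith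
    then show "\<forall>\<^sub>F n in sequentially. real n \<le> t (r n)" by simp
  qed
  have "isCont f a"
    using f continuous_on_eq_continuous_at[OF open_UNIV] by blast
  then have "(\<lambda>n. f (g (t (r n)))) \<longlonglongrightarrow> f a"
    using isCont_tendsto_compose[OF _ a, of f] by (simp add: o_def)
  moreover have "(\<lambda>n. f (g (t (r n)))) \<longlonglongrightarrow> w"
    using filterlim_compose[OF lim t_top] .
  ultimately have fa: "f a = w"
    by (rule LIMSEQ_unique)
  obtain e where "e > 0" and e: "\<And>x. f x = w \<Longrightarrow> x \<noteq> a \<Longrightarrow> \<not> dist x a < e"
    using isolated[OF fa] unfolding islimpt_approachable by auto
  define S where "S = sphere a (e/2)"
  have "x \<in> S \<Longrightarrow> f x \<noteq> w" for x
    using e[of x] \<open>e > 0\<close> unfolding S_def by (auto simp: dist_commute)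
  then have "w \<in> - f ` S" by auto
  moreover have "open (- f ` S)"
    unfolding S_def
    by (intro open_Compl compact_imp_closed compact_continuous_image continuous_on_subset[OF f]) auto
  ultimately have "\<forall>\<^sub>F t in at_top. f (g t) \<in> - f ` S"
    using topological_tendstoD[OF lim] by blast
  then obtain T0 where T0: "\<And>t. t \<ge> T0 \<Longrightarrow> f (g t) \<notin> f ` S"
    unfolding eventually_at_top_linorder by auto
  define T where "T = max 0 T0"
  have "\<forall>\<^sub>F n in sequentially. T \<le> t (r n)"
    using t_top unfolding filterlim_at_top by blast
  moreover have "\<forall>\<^sub>F n in sequentially. dist (g (t (r n))) a < e/2"
    using tendstoD[OF a, of "e/2"] \<open>e > 0\<close> by (simp add: o_def)
  ultimately have "\<forall>\<^sub>F n in sequentially. T \<le> t (r n) \<and> dist (g (t (r n))) a < e/2"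
    by eventually_elim simp
  then obtain n where n: "T \<le> t (r n)" "dist (g (t (r n))) a < e/2"
    using eventually_happens'[OF sequentially_bot] by blast
  have "continuous_on {T..} g"
    using g by (rule continuous_on_subset) (auto simp: T_def)
  then have "connected (g ` {T..})"
    by (rule connected_continuous_image) simp
  moreover have "g t \<notin> S" if "t \<ge> T" for t
    using T0[of t] that unfolding T_def by auto
  then have "g ` {T..} \<inter> frontier (ball a (e/2)) = {}"
    using \<open>e > 0\<close> unfolding S_def by (auto simp: frontier_ball)
  moreover have "g ` {T..} \<inter> ball a (e/2) \<noteq> {}"
    using n by (auto simp: dist_commute)
  ultimately have "g ` {T..} \<subseteq> ball a (e/2)"
    using connected_Int_frontier by blast
  then have "bounded (g ` {T..})"
    using bounded_ball bounded_subset by blast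
  with unbounded show False by blast
qed

section \<open>Approaching the cluster value through regular values\<close>

text \<open>Near a regular point the map is open, so its image contains an open set. The closed cluster
  set cannot fill that set, and the critical values, a null set, cannot fill the open
  remainder.\<close>

lemma regular_value_off_cluster_set_in_image:
  fixes f :: "real^'n::{finite,wellorder} \<Rightarrow> real^'n::{finite,wellorder}"
  assumes f: "C1_map f" and S: "nowhere_dense_in euclidean (critical_set f)"
    and C: "nowhere_dense_in (top_of_set B) (B \<inter> cluster_set_at_infinity f)" and "open B"
    and V: "open V" "V \<noteq> {}" "f ` V \<subseteq> B"
  obtains z where "z \<in> V" "f z \<notin> f ` critical_set f \<union> cluster_set_at_infinity f"
proof -
  have "\<not> V \<subseteq> critical_set f"
  proof
    assume "V \<subseteq> critical_set f"
    then have "V \<subseteq> interior (closure (critical_set f))"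
      using V(1) closure_subset by (intro interior_maximal) auto
    then show False
      using S V(2) by (simp add: nowhere_dense_in_def)
  qed
  then obtain x where x: "x \<in> V" "x \<notin> critical_set f"
    by blast
  obtain V' g where V': "x \<in> V'" "V' \<subseteq> V" "open (f ` V')"
    using local_homeomorphism_at_regular_point[OF f x(2)] V(1) x(1)
    by (rule local_homeomorphism_at_shrink)
  have "\<not> f ` V' \<subseteq> cluster_set_at_infinity f"
  proof
    assume sub: "f ` V' \<subseteq> cluster_set_at_infinity f"
    have "f ` V' \<subseteq> B"
      using V(3) V'(2) by blast
    then have "openin (top_of_set B) (f ` V')"
      using V'(3) by (simp add: open_subset)
    moreover have "f ` V' \<subseteq> top_of_set B closure_of (B \<inter> cluster_set_at_infinity f)"
      using sub \<open>f ` V' \<subseteq> B\<close> by (intro order_trans[OF _ closure_of_subset]) auto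
    ultimately have "f ` V' \<subseteq> top_of_set B interior_of (top_of_set B closure_of (B \<inter> cluster_set_at_infinity f))"
      by (intro interior_of_maximal)
    then show False
      using C V'(1) by (auto simp: nowhere_dense_in_def)
  qed
  then have "f ` V' - cluster_set_at_infinity f \<noteq> {}"
    by blast
  moreover have "open (f ` V' - cluster_set_at_infinity f)"
    using V'(3) closed_cluster_set_at_infinity by (rule open_Diff)
  ultimately have "\<not> negligible (f ` V' - cluster_set_at_infinity f)"
    by (intro open_not_negligible)
  then have "\<not> f ` V' - cluster_set_at_infinity f \<subseteq> f ` critical_set f"
    using negligible_critical_values[OF f] negligible_subset by blast
  then obtain z where "z \<in> V'" "f z \<notin> f ` critical_set f \<union> cluster_set_at_infinity f"
    by blast
  then show thesis
    using that[of z] V'(2) by blast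
qed

lemma regular_sequence_to_cluster_value:
  fixes f :: "real^'n::{finite,wellorder} \<Rightarrow> real^'n::{finite,wellorder}"
  assumes f: "C1_map f" and S: "nowhere_dense_in euclidean (critical_set f)"
    and C: "nowhere_dense_in (top_of_set B) (B \<inter> cluster_set_at_infinity f)"
    and B: "open B" "w \<in> B" and w: "w \<in> cluster_set_at_infinity f"
  obtains z where "filterlim z at_infinity sequentially" "(\<lambda>n. f (z n)) \<longlonglongrightarrow> w"
    "\<forall>n. f (z n) \<in> B - (f ` critical_set f \<union> cluster_set_at_infinity f)"
proof -
  have f_cont: "continuous_on UNIV f"
    using f by (rule C1_map_imp_continuous_on)
  have "\<exists>z. norm z \<ge> real n \<and> dist (f z) w < inverse (real (Suc n)) \<and>
      f z \<in> B - (f ` critical_set f \<union> cluster_set_at_infinity f)" for n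
  proof -
    define V where "V = {z. norm z > real n} \<inter> f -` (B \<inter> ball w (inverse (real (Suc n))))"
    have "open V"
      unfolding V_def using B(1)
      by (intro open_Int open_vimage[OF _ f_cont] open_Collect_less continuous_intros) auto
    have "open (B \<inter> ball w (inverse (real (Suc n))))" "w \<in> B \<inter> ball w (inverse (real (Suc n)))"
      using B by (auto intro: open_Int)
    then obtain d where d: "d > 0" "ball w d \<subseteq> B \<inter> ball w (inverse (real (Suc n)))"
      using open_contains_ball by meson
    obtain x where "norm x \<ge> real n + 1" "dist (f x) w < d"
      using w d(1) unfolding cluster_set_at_infinity_iff by blast
    then have "norm x > real n" "f x \<in> ball w d"
      by (auto simp: dist_commute)
    then have "V \<noteq> {}"
      using d(2) unfolding V_def by blast
    have "f ` V \<subseteq> B"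
      unfolding V_def by blast
    with f S C B(1) \<open>open V\<close> \<open>V \<noteq> {}\<close>
    obtain z where "z \<in> V" "f z \<notin> f ` critical_set f \<union> cluster_set_at_infinity f"
      by (rule regular_value_off_cluster_set_in_image)
    then show ?thesis
      unfolding V_def by (intro exI[of _ z]) (simp add: dist_commute)
  qed
  then obtain z where z: "\<And>n. norm (z n) \<ge> real n" "\<And>n. dist (f (z n)) w < inverse (real (Suc n))"
      "\<And>n. f (z n) \<in> B - (f ` critical_set f \<union> cluster_set_at_infinity f)"
    by metis
  have "filterlim (\<lambda>n. norm (z n)) at_top sequentially"
    by (rule filterlim_at_top_mono[OF filterlim_real_sequentially]) (use z(1) in auto)
  then have "filterlim z at_infinity sequentially"
    by (rule filterlim_norm_at_top_imp_at_infinity)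
  moreover have "(\<lambda>n. f (z n)) \<longlonglongrightarrow> w"
    using z(2) by (rule tendsto_of_dist_less_inverse_Suc)
  ultimately show thesis
    using z(3) by (intro that) auto
qed

section \<open>Cluster values are asymptotic values\<close>

text \<open>The two alternatives for \<open>w\<close> are used through this common consequence: the fibre is
  finite, or all its points are regular.\<close>

lemma isolated_in_fibre_of_Val:
  fixes f :: "real^'n \<Rightarrow> real^'n"
  assumes "C1_map f" and "Val f w < \<infinity> \<or> (Val f w = \<infinity> \<and> w \<notin> f ` critical_set f)"
    and "f a = w"
  shows "\<not> a islimpt (f -` {w})"
  using assms(2)
proof
  assume "Val f w < \<infinity>"
  then have "finite (f -` {w})"
    by (auto simp: Val_def vimage_def split: if_splits)
  then show ?thesis
    by (rule islimpt_finite)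
next
  assume "Val f w = \<infinity> \<and> w \<notin> f ` critical_set f"
  then have "a \<notin> critical_set f"
    using assms(3) by auto
  then have "local_homeomorphism_at f a"
    by (rule local_homeomorphism_at_regular_point[OF assms(1)])
  then show ?thesis
    unfolding assms(3)[symmetric] by (rule local_homeomorphism_at_isolated_in_fibre)
qed

theorem theorem6:
  fixes f :: "real^2 \<Rightarrow> real^2" and w0 :: "real^2" and \<epsilon> :: real
  assumes "C1_map f"
    and "nowhere_dense_in euclidean (critical_set f)"
    and "w0 \<in> cluster_set_at_infinity f"
    and "Val f w0 < \<infinity> \<or> (Val f w0 = \<infinity> \<and> w0 \<notin> f ` critical_set f)"
    and "\<epsilon> > 0"
    and "nowhere_dense_in (top_of_set (ball w0 \<epsilon>)) (ball w0 \<epsilon> \<inter> cluster_set_at_infinity f)"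
    and "finite (components (ball w0 \<epsilon> - (f ` critical_set f \<union> cluster_set_at_infinity f)))"
    and "\<And>U. U \<in> components (ball w0 \<epsilon> - (f ` critical_set f \<union> cluster_set_at_infinity f))
           \<Longrightarrow> uniformly_locally_arcwise_connected U"
  shows "asymptotic_value f w0"
proof -
  define W where "W = ball w0 \<epsilon> - (f ` critical_set f \<union> cluster_set_at_infinity f)"
  have f_cont: "continuous_on UNIV f"
    using assms(1) by (rule C1_map_imp_continuous_on)
  have "open W"
    unfolding W_def
    by (intro open_Diff open_ball closed_image_Un_cluster_set f_cont closed_critical_set assms(1))
  have "w0 \<in> ball w0 \<epsilon>"
    using assms(5) by simp
  obtain z where z_inf: "filterlim z at_infinity sequentially" and z_lim: "(\<lambda>n. f (z n)) \<longlonglongrightarrow> w0"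
    and zW: "\<forall>n. f (z n) \<in> W"
    unfolding W_def
    by (rule regular_sequence_to_cluster_value[OF assms(1,2,6) open_ball \<open>w0 \<in> ball w0 \<epsilon>\<close> assms(3)])
  (* Finitely many components: one of them contains infinitely many of the values. *)
  have "\<forall>n\<in>UNIV. \<exists>U\<in>components W. f (z n) \<in> U"
    using zW Union_components by blast
  then obtain U where U: "U \<in> components W" and inf_U: "infinite {n. f (z n) \<in> U}"
    using pigeonhole_infinite_rel[of "UNIV :: nat set" "components W" "\<lambda>n U. f (z n) \<in> U"] assms(7)
    unfolding W_def by auto
  obtain s where s: "strict_mono (s :: nat \<Rightarrow> nat)" "\<And>n. f (z (s n)) \<in> U"
    using infinite_enumerate[OF inf_U] by auto
  have ulac: "uniformly_locally_arcwise_connected U"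
    using assms(8) U unfolding W_def .
  have "(\<lambda>n. f (z (s n))) \<longlonglongrightarrow> w0"
    using LIMSEQ_subseq_LIMSEQ[OF z_lim s(1)] by (simp add: o_def)
  then obtain r p where r: "strict_mono r" and p: "continuous_on {0..} p" "p ` {0..} \<subseteq> U"
    and p_at: "\<forall>n. p (real n) = f (z (s (r n)))" and p_lim: "(p \<longlongrightarrow> w0) at_top"
    by (rule path_through_subsequence[OF ulac s(2)])
  define y where "y n = z (s (r n))" for n
  have "filterlim (\<lambda>n. s (r n)) at_top sequentially"
    using s(1) r by (intro filterlim_compose[OF filterlim_subseq filterlim_subseq])
  then have y_inf: "filterlim y at_infinity sequentially"
    unfolding y_def by (rule filterlim_compose[OF z_inf])
  have "U \<subseteq> W"
    using U by (rule in_components_subset)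
  then have regular: "local_homeomorphism_at f x" if "f x \<in> U" for x
    using that unfolding W_def
    by (intro local_homeomorphism_at_regular_point[OF assms(1)]) blast
  (* U misses both critical values and cluster values, so f covers it. *)
  have proper: "compact (f -` K)" if "K \<subseteq> U" "compact K" for K
    using that(1) \<open>U \<subseteq> W\<close> unfolding W_def
    by (intro compact_preimage_off_cluster_set[OF f_cont that(2)]) blast
  have cov: "covering_space (f -` U) f U"
  proof (rule proper_local_homeomorphism_imp_covering_space[OF f_cont])
    show "open U"
      using \<open>open W\<close> U by (rule open_components)
    show "connected U"
      using U by (rule in_components_connected)
    show "f -` U \<noteq> {}"
      using s(2) by blast
  qed (fact regular, fact proper)
  have "p 0 \<in> U"
    using p(2) by auto
  have "finite (f -` {p 0})"
    using \<open>p 0 \<in> U\<close> by (intro finite_compact_fibre_of_local_homeomorphism proper regular) auto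
  then have "finite {x \<in> f -` U. f x = p 0}"
    by (rule finite_subset[rotated]) auto
  moreover have "y n \<in> f -` U" "f (y n) = p (real n)" for n
    using s(2) p_at unfolding y_def by simp_all
  ultimately obtain g where g: "continuous_on {0..} g" "\<forall>t\<ge>0. f (g t) = p t"
    and inf_g: "infinite {n. g (real n) = y n}"
    by (rule lift_through_infinitely_many_points[OF cov p])
  have "((\<lambda>t. f (g t)) \<longlongrightarrow> w0) at_top"
  proof (rule Lim_transform_eventually[OF p_lim])
    show "\<forall>\<^sub>F t in at_top. p t = f (g t)"
      using eventually_ge_at_top[of 0] by eventually_elim (simp add: g(2))
  qed
  moreover have "filterlim g at_infinity at_top"
    using f_cont g(1) calculation
  proof (rule filterlim_at_infinity_of_isolated_fibre)
    show "\<not> a islimpt f -` {w0}" if "f a = w0" for a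
      using assms(1,4) that by (rule isolated_in_fibre_of_Val)
    show "\<not> bounded (g ` {T..})" for T
      (* g passes through y n at time n for infinitely many n, and y tends to infinity. *)
    proof
      assume "bounded (g ` {T..})"
      then obtain R where R: "\<And>t. t \<ge> T \<Longrightarrow> norm (g t) \<le> R"
        unfolding bounded_iff by auto
      have "\<forall>\<^sub>F n in sequentially. norm (y n) \<ge> R + 1"
        using filterlim_at_infinity_imp_norm_at_top[OF y_inf] by (simp add: filterlim_at_top)
      moreover have "\<forall>\<^sub>F n in sequentially. real n \<ge> T"
        using filterlim_real_sequentially by (simp add: filterlim_at_top)
      ultimately have "\<forall>\<^sub>F n in sequentially. g (real n) \<noteq> y n"
      proof eventually_elim
        case (elim n)
        then show ?case
          using R[of "real n"] by auto
      qed
      then have "finite {n. g (real n) = y n}"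
        unfolding cofinite_eq_sequentially[symmetric] eventually_cofinite by simp
      then show False
        using inf_g by blast
    qed
  qed
  ultimately show ?thesis
    using assms(3) g(1) unfolding asymptotic_value_def by blast
qed

end
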